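(* Let $\mathcal X$, $\mathcal Z$, $\mathcal Y$ be finite sets with $|\mathcal Z|=|\mathcal Y|$ (identified with each other, so that kernels from $\mathcal Z$ to $\mathcal Y$ can be composed). Let $\mathsf K_0$ be a kernel from $\mathcal X$ to $\mathcal Z$ satisfying $\alpha$-LDP for some $\alpha\ge0$. For some $n\in\mathbb N$, let $\mathsf K_1,\dots,\mathsf K_n$ be kernels from $\mathcal Z$ to $\mathcal Y$, each satisfying $\varepsilon$-PML on $\mathcal P_c(\mathcal Z)$ for some $0<c<|\mathcal Z|^{-1}$ and $\varepsilon\ge0$. Define $\mathsf K^{(n)}=\mathsf K_0\mathsf K_1\cdots\mathsf K_n$, $Q^{(n)}=U_X\mathsf K^{(n)}$ with $U_X$ the uniform distribution on $\mathcal X$, and $\mathcal Y^*=\mathrm{supp}(Q^{(n)})$. Then $\mathsf K^{(n)}$ satisfies $\alpha_n$-LDP for some $\alpha_n$ with $$\alpha_n\le\alpha\left(\frac{e^\alpha}{\min_{y\in\mathcal Y^*}Q^{(n)}(y)}\right)\eta_{\mathrm{TV}}(\varepsilon)^n,\qquad \eta_{\mathrm{TV}}(\varepsilon)=\min\left\{\frac{e^\varepsilon-1}{1+e^\varepsilon(1-c|\mathcal Z|)},\,1\right\}.$$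
   Context: A kernel between finite sets is a row-stochastic matrix $\mathsf K(y|x)$; products of kernels are matrix products, and $(P\mathsf K)(y)=\sum_xP(x)\mathsf K(y|x)$. A kernel $\mathsf K$ satisfies $\alpha$-LDP if $\mathsf K(y|x)\le e^\alpha\mathsf K(y|x')$ for all inputs $x,x'$ and outputs $y$. $\mathcal P_c(\mathcal Z)$ is the set of probability mass functions $P$ on $\mathcal Z$ with $P(z)\ge c$ for all $z$. A kernel $\mathsf K$ on $\mathcal Z$ satisfies $\varepsilon$-PML on $\mathcal P_c(\mathcal Z)$ if $\mathsf K(y|z)\le e^\varepsilon(P\mathsf K)(y)$ for all $z$, $y$ and all $P\in\mathcal P_c(\mathcal Z)$. *)

theory Defs
  imports "HOL-Analysis.Analysis"
begin

text \<open>
  A kernel from \<open>'x\<close> to \<open>'y\<close> is a matrix of type \<open>real ^ 'y ^ 'x\<close> whose entry \<open>K $ x $ y\<close> is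
  \<open>K(y|x)\<close>. Thus products of kernels are \<open>K ** L\<close> and \<open>PK\<close> is the row vector \<open>P v* K\<close>.
\<close>

definition is_pmf :: "real ^ 'z::finite \<Rightarrow> bool" where
  "is_pmf P \<longleftrightarrow> (\<forall>z. 0 \<le> P $ z) \<and> (\<Sum>z\<in>UNIV. P $ z) = 1"

definition is_kernel :: "real ^ 'y::finite ^ 'x::finite \<Rightarrow> bool" where
  "is_kernel K \<longleftrightarrow> (\<forall>x. is_pmf (K $ x))"

definition LDP :: "real \<Rightarrow> real ^ 'y::finite ^ 'x::finite \<Rightarrow> bool" where
  "LDP \<alpha> K \<longleftrightarrow> (\<forall>x x' y. K $ x $ y \<le> exp \<alpha> * K $ x' $ y)"

definition pmfs_ge :: "real \<Rightarrow> (real ^ 'z::finite) set" where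
  "pmfs_ge c = {P. is_pmf P \<and> (\<forall>z. c \<le> P $ z)}"

definition PML_on :: "(real ^ 'z::finite) set \<Rightarrow> real \<Rightarrow> real ^ 'y::finite ^ 'z \<Rightarrow> bool" where
  "PML_on \<P> \<epsilon> K \<longleftrightarrow> (\<forall>P\<in>\<P>. \<forall>z y. K $ z $ y \<le> exp \<epsilon> * (P v* K) $ y)"

definition uniform :: "real ^ 'x::finite" where
  "uniform = (\<chi> x. 1 / real CARD('x))"

definition supp :: "real ^ 'y::finite \<Rightarrow> 'y set" where
  "supp Q = {y. Q $ y \<noteq> 0}"

text \<open>
  The identification of the alphabets \<open>'z\<close> and \<open>'y\<close> is an explicit map \<open>\<iota> :: 'y \<Rightarrow> 'z\<close>, assumed
  bijective where it is used. It serves to read the outputs of \<open>K\<^sub>0\<close>, and the inputs of the kernels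
  \<open>K\<^sub>1, K\<^sub>2, \<dots>\<close>, as elements of \<open>'y\<close>, so that \<open>kernel_chain \<iota> K0 K n\<close> is \<open>K\<^sub>0 K\<^sub>1 \<cdots> K\<^sub>n\<close>.
\<close>

definition relabel_outputs ::
    "('y::finite \<Rightarrow> 'z::finite) \<Rightarrow> real ^ 'z ^ 'x::finite \<Rightarrow> real ^ 'y ^ 'x" where
  "relabel_outputs \<iota> K = (\<chi> x y. K $ x $ \<iota> y)"

definition relabel_inputs ::
    "('y::finite \<Rightarrow> 'z::finite) \<Rightarrow> real ^ 'w::finite ^ 'z \<Rightarrow> real ^ 'w ^ 'y" where
  "relabel_inputs \<iota> K = (\<chi> y w. K $ \<iota> y $ w)"

primrec kernel_chain ::
    "('y::finite \<Rightarrow> 'z::finite) \<Rightarrow> real ^ 'z ^ 'x::finite \<Rightarrow> (nat \<Rightarrow> real ^ 'y ^ 'z) \<Rightarrow> nat \<Rightarrow> real ^ 'y ^ 'x"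
where
  "kernel_chain \<iota> K0 K 0 = relabel_outputs \<iota> K0"
| "kernel_chain \<iota> K0 K (Suc n) = kernel_chain \<iota> K0 K n ** relabel_inputs \<iota> (K (Suc n))"

text \<open>The argument \<open>N\<close> is the cardinality of the input alphabet.\<close>

definition eta_TV :: "nat \<Rightarrow> real \<Rightarrow> real \<Rightarrow> real" where
  "eta_TV N c \<epsilon> = min ((exp \<epsilon> - 1) / (1 + exp \<epsilon> * (1 - c * real N))) 1"

end

theory Submission
  imports Defs
begin

text \<open>
  Evaluating the PML inequality at the extreme points of \<open>pmfs_ge c\<close>, once on an event \<open>A\<close> and once
  on its complement, bounds the total variation distance of any two rows of \<open>K i\<close> by
  \<open>eta_TV\<close>. Hence each \<open>K i\<close> contracts total variation by this factor, and the rows of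
  \<open>K\<^sub>0 \<cdots> K\<^sub>n\<close> are within \<open>\<alpha> * eta_TV ^ n\<close> of each other. Post-processing preserves
  \<open>\<alpha>\<close>-LDP, so every entry in a column \<open>y\<close> is at least \<open>exp (- \<alpha>) * Q y\<close>, which turns the additive
  bound into a bound on ratios via \<open>1 + r \<le> exp r\<close>.
\<close>

section \<open>Stochastic matrices, relabelling and products\<close>

lemma is_kernel_nonneg: "is_kernel K \<Longrightarrow> 0 \<le> K $ x $ y"
  by (simp add: is_kernel_def is_pmf_def)

lemma is_kernel_sum: "is_kernel K \<Longrightarrow> (\<Sum>y\<in>UNIV. K $ x $ y) = 1"
  by (simp add: is_kernel_def is_pmf_def)

lemma is_kernel_matrix_mult:
  assumes "is_kernel K" "is_kernel L"
  shows "is_kernel (K ** L)"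
proof -
  have "(\<Sum>y\<in>UNIV. \<Sum>z\<in>UNIV. K $ x $ z * L $ z $ y) = 1" for x
    by (subst sum.swap) (simp add: sum_distrib_left[symmetric] is_kernel_sum assms)
  then show ?thesis
    by (auto simp: is_kernel_def is_pmf_def matrix_matrix_mult_def
        intro!: sum_nonneg mult_nonneg_nonneg is_kernel_nonneg assms)
qed

lemma is_kernel_relabel_inputs: "is_kernel K \<Longrightarrow> is_kernel (relabel_inputs \<iota> K)"
  by (simp add: is_kernel_def is_pmf_def relabel_inputs_def)

text \<open>A bijection only permutes the entries of each row, so the row sums stay 1; relabelling
  inputs merely selects rows.\<close>

lemma is_kernel_relabel_outputs:
  assumes "is_kernel K" "bij \<iota>"
  shows "is_kernel (relabel_outputs \<iota> K)"
  using assms sum.reindex_bij_betw[OF assms(2), of "\<lambda>z. K $ x $ z" for x]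
  by (simp add: is_kernel_def is_pmf_def relabel_outputs_def)

lemma is_kernel_kernel_chain:
  assumes "bij \<iota>" "is_kernel K0" "\<And>i. i \<in> {1..n} \<Longrightarrow> is_kernel (K i)"
  shows "is_kernel (kernel_chain \<iota> K0 K n)"
  using assms(3)
  by (induction n)
    (simp_all add: assms is_kernel_relabel_outputs is_kernel_matrix_mult is_kernel_relabel_inputs)

section \<open>Local differential privacy along the chain\<close>

lemma LDP_matrix_mult:
  assumes "LDP \<alpha> K" "is_kernel L"
  shows "LDP \<alpha> (K ** L)"
proof -
  \<comment> \<open>The nonnegative weights \<open>L $ z $ y\<close> are the same for the rows
    \<open>x\<close> and \<open>x'\<close>, so the ratio bound passes to the weighted sums.\<close>
  have "(\<Sum>z\<in>UNIV. K $ x $ z * L $ z $ y) \<le> exp \<alpha> * (\<Sum>z\<in>UNIV. K $ x' $ z * L $ z $ y)" for x x' y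
    unfolding sum_distrib_left mult.assoc[symmetric]
    using assms by (intro sum_mono mult_right_mono is_kernel_nonneg) (auto simp: LDP_def)
  then show ?thesis
    by (simp add: LDP_def matrix_matrix_mult_def)
qed

lemma LDP_kernel_chain:
  assumes "LDP \<alpha> K0" "\<And>i. i \<in> {1..n} \<Longrightarrow> is_kernel (K i)"
  shows "LDP \<alpha> (kernel_chain \<iota> K0 K n)"
  using assms(2)
proof (induction n)
  case 0
  then show ?case
    using assms(1) by (simp add: LDP_def relabel_outputs_def)
qed (simp add: LDP_matrix_mult is_kernel_relabel_inputs)

text \<open>Row \<open>x'\<close> retains at least the fraction \<open>exp (- \<alpha>)\<close> of
  each entry of row \<open>x\<close>, so the excess on any event is at most
  \<open>1 - exp (- \<alpha>)\<close>. This supplies the initial factor \<alpha> before any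
  contraction.\<close>

lemma LDP_tv_le:
  assumes "is_kernel K" "LDP \<alpha> K" "0 \<le> \<alpha>"
  shows "(\<Sum>y\<in>A. K $ x $ y - K $ x' $ y) \<le> \<alpha>"
proof -
  have "K $ x $ y - K $ x' $ y \<le> (1 - exp (- \<alpha>)) * K $ x $ y" for y
  proof -
    have "K $ x $ y \<le> exp \<alpha> * K $ x' $ y"
      using assms(2) by (simp add: LDP_def)
    then show ?thesis
      by (simp add: exp_minus field_simps)
  qed
  then have "(\<Sum>y\<in>A. K $ x $ y - K $ x' $ y) \<le> (1 - exp (- \<alpha>)) * (\<Sum>y\<in>A. K $ x $ y)"
    by (simp add: sum_distrib_left sum_mono)
  also have "\<dots> \<le> (1 - exp (- \<alpha>)) * (\<Sum>y\<in>UNIV. K $ x $ y)"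
    using assms by (intro mult_left_mono sum_mono2 is_kernel_nonneg) auto
  also have "\<dots> \<le> \<alpha>"
    using exp_ge_add_one_self[of "- \<alpha>"] by (simp add: is_kernel_sum assms)
  finally show ?thesis .
qed

section \<open>From PML to total variation between rows\<close>

lemma PML_on_pmfs_ge_vertex:
  fixes K :: "real ^ 'y::finite ^ 'z::finite"
  assumes "PML_on (pmfs_ge c) \<epsilon> K" "0 \<le> c" "c * real CARD('z) \<le> 1"
  shows "K $ z $ y \<le> exp \<epsilon> * (c * (\<Sum>w\<in>UNIV. K $ w $ y) + (1 - c * real CARD('z)) * K $ z' $ y)"
proof -
  \<comment> \<open>An extreme point of \<open>pmfs_ge c\<close>: every letter gets the minimal mass
    \<open>c\<close>, and \<open>z'\<close> receives all the remaining mass.\<close>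
  define P :: "real ^ 'z" where
    "P = (\<chi> w. c + (if w = z' then 1 - c * real CARD('z) else 0))"
  have "P \<in> pmfs_ge c"
    using assms(2,3) by (simp add: pmfs_ge_def is_pmf_def P_def sum.distrib)
  then have "K $ z $ y \<le> exp \<epsilon> * (P v* K) $ y"
    using assms(1) by (simp add: PML_on_def)
  also have "(P v* K) $ y
      = (\<Sum>w\<in>UNIV. c * K $ w $ y + (if w = z' then (1 - c * real CARD('z)) * K $ w $ y else 0))"
    by (auto simp: vector_matrix_mult_def P_def algebra_simps intro!: sum.cong)
  also have "\<dots> = c * (\<Sum>w\<in>UNIV. K $ w $ y) + (1 - c * real CARD('z)) * K $ z' $ y"
    by (simp add: sum.distrib sum_distrib_left)
  finally show ?thesis .
qed

lemma PML_on_pmfs_ge_tv_le: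
  fixes K :: "real ^ 'y::finite ^ 'z::finite"
  assumes "is_kernel K" "PML_on (pmfs_ge c) \<epsilon> K" "0 \<le> c" "c * real CARD('z) \<le> 1"
  shows "(\<Sum>y\<in>A. K $ z $ y) - (\<Sum>y\<in>A. K $ z' $ y) \<le> eta_TV CARD('z) c \<epsilon>"
proof -
  define k where "k w B = (\<Sum>y\<in>B. K $ w $ y)" for w B
  define N where "N = real CARD('z)"
  \<comment> \<open>Both sides of the entrywise inequality are linear in the column, so summing over
    \<open>y\<close> in \<open>B\<close> extends it to events.\<close>
  have vertex: "k w B \<le> exp \<epsilon> * (c * (\<Sum>v\<in>UNIV. k v B) + (1 - c * N) * k w' B)" for w w' B
  proof -
    have "k w B \<le> (\<Sum>y\<in>B. exp \<epsilon> * (c * (\<Sum>v\<in>UNIV. K $ v $ y) + (1 - c * N) * K $ w' $ y))"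
      unfolding k_def N_def by (intro sum_mono PML_on_pmfs_ge_vertex assms)
    also have "\<dots> = exp \<epsilon> * (c * (\<Sum>y\<in>B. \<Sum>v\<in>UNIV. K $ v $ y) + (1 - c * N) * k w' B)"
      by (simp add: k_def sum_distrib_left[symmetric] sum.distrib)
    also have "(\<Sum>y\<in>B. \<Sum>v\<in>UNIV. K $ v $ y) = (\<Sum>v\<in>UNIV. k v B)"
      unfolding k_def by (rule sum.swap)
    finally show ?thesis .
  qed
  have compl: "k w (- A) = 1 - k w A" for w
    using sum.subset_diff[of A UNIV "\<lambda>y. K $ w $ y"]
    by (simp add: k_def is_kernel_sum assms Compl_eq_Diff_UNIV)
  have compl_sum: "(\<Sum>v\<in>UNIV. k v (- A)) = N - (\<Sum>v\<in>UNIV. k v A)"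
    by (simp add: compl sum_subtractf N_def)
  \<comment> \<open>Add the inequality for \<open>A\<close> with extreme point at \<open>z'\<close>
    to the one for \<open>- A\<close> with extreme point at \<open>z\<close>. The sums over all
    inputs combine to \<open>N\<close>, leaving only the difference
    \<open>k z A - k z' A\<close>.\<close>
  have "1 + (k z A - k z' A) \<le> exp \<epsilon> * (1 - (1 - c * N) * (k z A - k z' A))"
    using vertex[of z A z'] vertex[of z' "- A" z] unfolding compl_sum unfolding compl
    by (simp add: algebra_simps)
  then have "(k z A - k z' A) * (1 + exp \<epsilon> * (1 - c * N)) \<le> exp \<epsilon> - 1"
    by (simp add: algebra_simps)
  moreover have "0 < 1 + exp \<epsilon> * (1 - c * N)"
    using assms(4) by (simp add: N_def add_pos_nonneg)
  ultimately have "k z A - k z' A \<le> (exp \<epsilon> - 1) / (1 + exp \<epsilon> * (1 - c * N))"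
    by (simp add: pos_le_divide_eq)
  \<comment> \<open>The cap 1 in \<open>eta_TV\<close>: a difference of two probabilities.\<close>
  moreover have "0 \<le> k z' A" "0 \<le> k z (- A)"
    by (auto simp: k_def intro!: sum_nonneg is_kernel_nonneg assms)
  then have "k z A - k z' A \<le> 1"
    by (simp add: compl)
  ultimately show ?thesis
    by (simp add: eta_TV_def k_def N_def)
qed

section \<open>Contraction of total variation\<close>

lemma sum_mult_le_oscillation:
  fixes d f :: "'a::finite \<Rightarrow> real"
  assumes "sum d UNIV = 0" "\<And>B. sum d B \<le> t" "\<And>z z'. f z - f z' \<le> \<eta>"
  shows "(\<Sum>z\<in>UNIV. d z * f z) \<le> \<eta> * t"
proof -
  \<comment> \<open>Since \<open>d\<close> sums to 0, \<open>f\<close> may be shifted by its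
    minimum, so that its values lie between 0 and \<eta>.\<close>
  define m where "m = Min (range f)"
  have "m \<in> range f"
    unfolding m_def by (intro Min_in) auto
  then obtain z0 where z0: "m = f z0"
    by blast
  have m_le: "m \<le> f z" for z
    by (simp add: m_def)
  have \<eta>: "0 \<le> \<eta>"
    using assms(3)[of z0 z0] by simp
  have "(\<Sum>z\<in>UNIV. d z * f z) = (\<Sum>z\<in>UNIV. d z * (f z - m))"
    by (simp add: right_diff_distrib sum_subtractf sum_distrib_right[symmetric] assms(1))
  \<comment> \<open>Terms with nonpositive \<open>d z\<close> are at most 0. The others form the
    event where \<open>d\<close> is positive, whose mass is at most \<open>t\<close>.\<close>
  also have "\<dots> \<le> (\<Sum>z\<in>UNIV. if 0 < d z then \<eta> * d z else 0)"
  proof (rule sum_mono)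
    fix z
    show "d z * (f z - m) \<le> (if 0 < d z then \<eta> * d z else 0)"
      using assms(3)[of z z0] m_le[of z]
      by (auto simp: z0 mult.commute mult_nonpos_nonneg intro: mult_right_mono)
  qed
  also have "\<dots> = \<eta> * sum d {z. 0 < d z}"
    by (simp add: sum.If_cases sum_distrib_left)
  also have "\<dots> \<le> \<eta> * t"
    using \<eta> assms(2) by (rule mult_left_mono[rotated])
  finally show ?thesis .
qed

text \<open>Dobrushin contraction: apply the oscillation bound with \<open>d\<close> the difference
  of two rows of \<open>K\<close> and \<open>f z\<close> the mass that row \<open>z\<close> of
  \<open>L\<close> gives to \<open>A\<close>.\<close>

lemma tv_matrix_mult_le:
  fixes K :: "real ^ 'z::finite ^ 'x::finite" and L :: "real ^ 'y::finite ^ 'z"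
  assumes "is_kernel K" "\<And>B. (\<Sum>z\<in>B. K $ x $ z - K $ x' $ z) \<le> t"
    and "\<And>z z'. (\<Sum>y\<in>A. L $ z $ y) - (\<Sum>y\<in>A. L $ z' $ y) \<le> \<eta>"
  shows "(\<Sum>y\<in>A. (K ** L) $ x $ y - (K ** L) $ x' $ y) \<le> \<eta> * t"
proof -
  have "(\<Sum>y\<in>A. (K ** L) $ x $ y - (K ** L) $ x' $ y)
      = (\<Sum>y\<in>A. \<Sum>z\<in>UNIV. (K $ x $ z - K $ x' $ z) * L $ z $ y)"
    by (simp add: matrix_matrix_mult_def left_diff_distrib sum_subtractf)
  also have "\<dots> = (\<Sum>z\<in>UNIV. (K $ x $ z - K $ x' $ z) * (\<Sum>y\<in>A. L $ z $ y))"
    by (subst sum.swap) (simp add: sum_distrib_left)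
  also have "\<dots> \<le> \<eta> * t"
    using assms by (intro sum_mult_le_oscillation) (auto simp: sum_subtractf is_kernel_sum)
  finally show ?thesis .
qed

lemma tv_kernel_chain_le:
  fixes K0 :: "real ^ 'z::finite ^ 'x::finite" and K :: "nat \<Rightarrow> real ^ 'y::finite ^ 'z"
  assumes "bij \<iota>" "is_kernel K0" "0 \<le> \<alpha>" "LDP \<alpha> K0" "0 \<le> c" "c * real CARD('z) \<le> 1"
    and "\<And>i. i \<in> {1..n} \<Longrightarrow> is_kernel (K i)"
    and "\<And>i. i \<in> {1..n} \<Longrightarrow> PML_on (pmfs_ge c) \<epsilon> (K i)"
  shows "(\<Sum>y\<in>A. kernel_chain \<iota> K0 K n $ x $ y - kernel_chain \<iota> K0 K n $ x' $ y)
    \<le> \<alpha> * eta_TV CARD('z) c \<epsilon> ^ n"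
  using assms(7,8)
\<comment> \<open>Bounding one event after a further kernel uses the bound for all events before it,
  hence \<open>A\<close> is generalised.\<close>
proof (induction n arbitrary: A)
  case 0
  have "is_kernel (kernel_chain \<iota> K0 K 0)" "LDP \<alpha> (kernel_chain \<iota> K0 K 0)"
    using assms by (auto intro: is_kernel_kernel_chain LDP_kernel_chain simp del: kernel_chain.simps)
  from LDP_tv_le[OF this assms(3)] show ?case
    by simp
next
  case (Suc n)
  have "is_kernel (kernel_chain \<iota> K0 K n)"
    using Suc.prems assms by (intro is_kernel_kernel_chain) auto
  moreover have "(\<Sum>y\<in>A. relabel_inputs \<iota> (K (Suc n)) $ w $ y)
      - (\<Sum>y\<in>A. relabel_inputs \<iota> (K (Suc n)) $ w' $ y) \<le> eta_TV CARD('z) c \<epsilon>" for w w'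
    using PML_on_pmfs_ge_tv_le[of "K (Suc n)" c \<epsilon> "\<iota> w" A "\<iota> w'"] Suc.prems assms
    by (simp add: relabel_inputs_def)
  ultimately have "(\<Sum>y\<in>A. kernel_chain \<iota> K0 K (Suc n) $ x $ y - kernel_chain \<iota> K0 K (Suc n) $ x' $ y)
      \<le> eta_TV CARD('z) c \<epsilon> * (\<alpha> * eta_TV CARD('z) c \<epsilon> ^ n)"
    unfolding kernel_chain.simps using Suc.prems by (intro tv_matrix_mult_le Suc.IH) auto
  then show ?case
    by (simp add: mult.left_commute)
qed

section \<open>From additive bounds to ratios\<close>

lemma LDP_uniform_mult_le:
  fixes K :: "real ^ 'y::finite ^ 'x::finite"
  assumes "LDP \<alpha> K"
  shows "(uniform v* K) $ y \<le> exp \<alpha> * K $ x $ y"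
proof -
  have "(uniform v* K) $ y = (\<Sum>x'\<in>UNIV. K $ x' $ y) / real CARD('x)"
    by (simp add: vector_matrix_mult_def uniform_def sum_divide_distrib)
  also have "\<dots> \<le> (\<Sum>x'\<in>(UNIV :: 'x set). exp \<alpha> * K $ x $ y) / real CARD('x)"
    using assms by (intro divide_right_mono sum_mono) (auto simp: LDP_def)
  finally show ?thesis
    by simp
qed

theorem proposition6:
  fixes K0 :: "real ^ 'z::finite ^ 'x::finite"
    and K :: "nat \<Rightarrow> real ^ 'y::finite ^ 'z"
    and \<iota> :: "'y \<Rightarrow> 'z"
    and \<alpha> \<epsilon> c :: real
    and n :: nat
  assumes "CARD('z) = CARD('y)"
    and "bij \<iota>"
    and "is_kernel K0" and "0 \<le> \<alpha>" and "LDP \<alpha> K0"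
    and "0 < c" and "c < 1 / real CARD('z)" and "0 \<le> \<epsilon>"
    and "\<And>i. i \<in> {1..n} \<Longrightarrow> is_kernel (K i)"
    and "\<And>i. i \<in> {1..n} \<Longrightarrow> PML_on (pmfs_ge c) \<epsilon> (K i)"
  shows "let Kn = kernel_chain \<iota> K0 K n;
             Q = uniform v* Kn;
             Ystar = supp Q
         in \<exists>\<alpha>n. LDP \<alpha>n Kn \<and>
              \<alpha>n \<le> \<alpha> * (exp \<alpha> / Min ((\<lambda>y. Q $ y) ` Ystar)) * eta_TV CARD('z) c \<epsilon> ^ n"
proof -
  define Kn where "Kn = kernel_chain \<iota> K0 K n"
  define Q :: "real ^ 'y" where "Q = uniform v* Kn"
  define q where "q = Min ((\<lambda>y. Q $ y) ` supp Q)"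
  define t where "t = \<alpha> * eta_TV CARD('z) c \<epsilon> ^ n"
  have cN: "c * real CARD('z) \<le> 1"
    using assms(7) by (simp add: field_simps)
  have kernel: "is_kernel Kn"
    unfolding Kn_def using assms by (intro is_kernel_kernel_chain)
  have LDP: "LDP \<alpha> Kn"
    unfolding Kn_def using assms by (intro LDP_kernel_chain)
  have tv: "(\<Sum>y\<in>A. Kn $ x $ y - Kn $ x' $ y) \<le> t" for A x x'
    unfolding Kn_def t_def using assms cN by (intro tv_kernel_chain_le) auto
  \<comment> \<open>The empty event has difference 0, which gives the sign of \<open>t\<close>
    without examining \<open>eta_TV\<close>.\<close>
  have t: "0 \<le> t"
    using tv[where A = "{}"] by simp
  have Q_eq: "Q $ y = (\<Sum>x\<in>UNIV. Kn $ x $ y) / real CARD('x)" for y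
    by (simp add: Q_def vector_matrix_mult_def uniform_def sum_divide_distrib)
  have "Kn $ x $ y \<le> exp (exp \<alpha> * t / q) * Kn $ x' $ y" for x x' y
  proof (cases "y \<in> supp Q")
    case True
    have Q_nonneg: "0 \<le> Q $ w" for w
      by (simp add: Q_eq sum_nonneg is_kernel_nonneg kernel)
    \<comment> \<open>The minimum is attained on the support, where \<open>Q\<close> is nonzero, so
      \<open>q\<close> is positive.\<close>
    have "q \<in> (\<lambda>y. Q $ y) ` supp Q"
      unfolding q_def using True by (intro Min_in) auto
    then have q: "0 < q"
      using Q_nonneg by (auto simp: supp_def less_le)
    have "q \<le> Q $ y"
      unfolding q_def using True by (intro Min_le) auto
    also have "\<dots> \<le> exp \<alpha> * Kn $ x' $ y"
      unfolding Q_def by (rule LDP_uniform_mult_le[OF LDP])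
    finally have "t * q \<le> t * (exp \<alpha> * Kn $ x' $ y)"
      using t by (rule mult_left_mono)
    then have "t \<le> exp \<alpha> * t / q * Kn $ x' $ y"
      using q by (simp add: field_simps)
    then have "Kn $ x $ y \<le> (1 + exp \<alpha> * t / q) * Kn $ x' $ y"
      using tv[where A = "{y}" and x = x and x' = x'] by (simp add: distrib_right)
    also have "\<dots> \<le> exp (exp \<alpha> * t / q) * Kn $ x' $ y"
      by (intro mult_right_mono exp_ge_add_one_self is_kernel_nonneg kernel)
    finally show ?thesis .
  next
    case False
    \<comment> \<open>Off the support a sum of nonnegative entries vanishes, so the whole column is
      0.\<close>
    then have "Kn $ w $ y = 0" for w
      by (simp add: supp_def Q_eq sum_nonneg_eq_0_iff is_kernel_nonneg kernel)
    then show ?thesis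
      by simp
  qed
  \<comment> \<open>The claimed bound itself serves as the witness for
    \<open>\<alpha>n\<close>.\<close>
  then have "LDP (exp \<alpha> * t / q) Kn"
    by (simp add: LDP_def)
  moreover have "exp \<alpha> * t / q = \<alpha> * (exp \<alpha> / q) * eta_TV CARD('z) c \<epsilon> ^ n"
    by (simp add: t_def)
  ultimately show ?thesis
    unfolding Let_def Kn_def q_def Q_def by (metis order_refl)
qed

end
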